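(* There are $T_{3.5}$ (Tychonoff) topological spaces $X$ and $Y$ such that $\mathrm{Nt}(X\times Y)<\min\{\mathrm{Nt}(X),\mathrm{Nt}(Y)\}$.
   Context: For a cardinal $\kappa$, a family $\mathcal B$ of sets is called $\kappa^{\mathrm{op}}$-like if for every $U\in\mathcal B$ the set $\{V\in\mathcal B: U\subseteq V\}$ has cardinality $<\kappa$. The Noetherian type $\mathrm{Nt}(X)$ of a topological space $X$ is the least infinite cardinal $\kappa$ such that $X$ has a base which is $\kappa^{\mathrm{op}}$-like. The product carries the usual product topology. *)

theory Defs
  imports "HOL-Analysis.Analysis"
begin

unbundle cardinal_syntax

definition Tychonoff_space :: "'a topology \<Rightarrow> bool" where
  "Tychonoff_space X \<longleftrightarrow> completely_regular_space X \<and> Hausdorff_space X"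

definition base_of :: "'a topology \<Rightarrow> 'a set set \<Rightarrow> bool" where
  "base_of X B \<longleftrightarrow> openin X = arbitrary union_of (\<lambda>U. U \<in> B)"

text \<open>Cardinals are the cardinal well-orders of the library, compared by \<open>\<le>o\<close> and \<open><o\<close>
  across arbitrary types.\<close>

definition op_like :: "'k rel \<Rightarrow> 'a set set \<Rightarrow> bool" where
  "op_like \<kappa> B \<longleftrightarrow> (\<forall>U\<in>B. |{V \<in> B. U \<subseteq> V}| <o \<kappa>)"

definition has_op_like_base :: "'a topology \<Rightarrow> 'k rel \<Rightarrow> bool" where
  "has_op_like_base X \<kappa> \<longleftrightarrow> (\<exists>B. base_of X B \<and> op_like \<kappa> B)"

definition is_Noetherian_type :: "'a topology \<Rightarrow> 'k rel \<Rightarrow> bool" where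
  "is_Noetherian_type X \<kappa> \<longleftrightarrow>
     Cinfinite \<kappa> \<and> has_op_like_base X \<kappa> \<and>
     (\<forall>\<mu> :: 'k rel. Cinfinite \<mu> \<and> has_op_like_base X \<mu> \<longrightarrow> \<kappa> \<le>o \<mu>)"

text \<open>The type \<open>('a set + nat) set\<close> is large enough to carry a suitable infinite cardinal for
  every topology on \<open>'a\<close>; \<open>Nt_is_Noetherian_type\<close> and \<open>Nt_least\<close> below show that \<open>Nt X\<close>
  is well defined and least among the cardinals of all types.\<close>

definition Nt :: "'a topology \<Rightarrow> ('a set + nat) set rel" where
  "Nt X = (SOME \<kappa>. is_Noetherian_type X \<kappa>)"

definition card_min :: "'k rel \<Rightarrow> 'k rel \<Rightarrow> 'k rel" where
  "card_min \<kappa> \<mu> = (if \<kappa> \<le>o \<mu> then \<kappa> else \<mu>)"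

lemma has_op_like_base_mono:
  assumes "has_op_like_base X \<kappa>" "\<kappa> \<le>o \<mu>"
  shows "has_op_like_base X \<mu>"
  using assms unfolding has_op_like_base_def op_like_def
  by (meson ordLess_ordLeq_trans)

lemma ex_has_op_like_base:
  fixes X :: "'a topology"
  shows "\<exists>\<kappa> :: ('a set + nat) set rel. Cinfinite \<kappa> \<and> has_op_like_base X \<kappa>"
proof -
  let ?T = "UNIV :: ('a set + nat) set"
  let ?\<kappa> = "cardSuc |?T|"
  have "infinite ?T"
    by simp
  then have "Cinfinite |?T|"
    using card_of_Card_order[of ?T] by (simp add: cinfinite_def Field_card_of)
  then have inf: "Cinfinite ?\<kappa>"
    by (rule Cinfinite_cardSuc)
  have "|A| <o ?\<kappa>" for A :: "'a set set"
  proof -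
    have "|A| \<le>o |?T|"
      by (rule card_of_ordLeqI[of Inl]) auto
    then show ?thesis
      using cardSuc_greater card_of_Card_order ordLeq_ordLess_trans by blast
  qed
  moreover have "base_of X {U. openin X U}"
    unfolding base_of_def openin_topology_base_unique by auto
  ultimately have "has_op_like_base X ?\<kappa>"
    unfolding has_op_like_base_def op_like_def by blast
  with inf show ?thesis by blast
qed

lemma Nt_is_Noetherian_type: "is_Noetherian_type X (Nt X)"
proof -
  let ?R = "{\<kappa> :: ('a set + nat) set rel. Cinfinite \<kappa> \<and> has_op_like_base X \<kappa>}"
  have "?R \<noteq> {}"
    using ex_has_op_like_base by blast
  moreover have "\<forall>\<kappa>\<in>?R. Well_order \<kappa>"
    by (auto dest: card_order_on_well_order_on)
  ultimately have "\<exists>\<kappa>\<in>?R. \<forall>\<mu>\<in>?R. \<kappa> \<le>o \<mu>"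
    by (rule exists_minim_Well_order)
  then obtain \<kappa> where "\<kappa> \<in> ?R" and min: "\<forall>\<mu>\<in>?R. \<kappa> \<le>o \<mu>" ..
  then have "is_Noetherian_type X \<kappa>"
    unfolding is_Noetherian_type_def by simp
  then show ?thesis
    unfolding Nt_def by (rule someI)
qed

lemma Nt_least:
  fixes X :: "'a topology" and \<mu> :: "'k rel"
  assumes \<mu>: "Cinfinite \<mu>" "has_op_like_base X \<mu>"
  shows "Nt X \<le>o \<mu>"
proof (rule ccontr)
  note N = Nt_is_Noetherian_type[of X, unfolded is_Noetherian_type_def]
  assume "\<not> Nt X \<le>o \<mu>"
  then have less: "\<mu> <o Nt X"
    using not_ordLeq_iff_ordLess[of \<mu> "Nt X"] N \<mu>(1) by (auto dest: card_order_on_well_order_on)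
  then have "|Field \<mu>| \<le>o |Field (Nt X)|"
    by (simp add: card_of_mono2 ordLess_imp_ordLeq)
  then obtain f where "inj_on f (Field \<mu>)" "f ` Field \<mu> \<subseteq> Field (Nt X)"
    unfolding card_of_ordLeq[symmetric] by blast
  then have "|Field \<mu>| =o |f ` Field \<mu>|"
    using card_of_ordIsoI inj_on_imp_bij_betw by blast
  then have iso: "\<mu> =o |f ` Field \<mu>|"
    using \<mu> card_of_Field_ordIso ordIso_symmetric ordIso_transitive by blast
  then have "Cinfinite |f ` Field \<mu>|"
    using \<mu> Cinfinite_cong by blast
  moreover have "has_op_like_base X |f ` Field \<mu>|"
    using has_op_like_base_mono \<mu>(2) iso ordIso_iff_ordLeq by blast
  ultimately have "Nt X \<le>o |f ` Field \<mu>|"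
    using N by blast
  then have "Nt X \<le>o \<mu>"
    using iso ordIso_symmetric ordLeq_ordIso_trans by blast
  with less show False
    using not_ordLess_ordLeq by blast
qed

end

theory Submission
  imports Defs
begin

text \<open>
  Let \<open>\<lambda>\<close> be the successor cardinal of the continuum, and for \<open>S \<subseteq> \<lambda>\<close> let \<open>\<D> S\<close> be the ideal of
  the countable subsets of \<open>\<lambda>\<close> all of whose limits of increasing \<open>\<omega>\<close>-sequences lie in \<open>S\<close>. The
  space \<open>X S\<close> is the power set of \<open>\<lambda>\<close>, where a neighbourhood base of \<open>A\<close> is formed by the sets of
  all \<open>B\<close> that agree with \<open>A\<close> on a given \<open>C \<in> \<D> S\<close>. It is Hausdorff and zero-dimensional. The
  neighbourhood filter of every point, ordered by reverse inclusion, looks like the directed set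
  \<open>\<D> S\<close>, and that of a point of \<open>X S \<times> X T\<close> looks like \<open>\<D> S \<times> \<D> T\<close>. The spaces of the theorem are
  \<open>X S\<close> and \<open>X (- S)\<close>, where both \<open>S\<close> and its complement are stationary among the points of cofinality
  \<open>\<omega>\<close>.

  The product has an \<open>\<omega>\<^sup>o\<^sup>p\<close>-like base. An infinite set of ordinals contains an increasing
  \<open>\<omega>\<close>-sequence, and its limit cannot lie in both \<open>S\<close> and \<open>- S\<close>, so that \<open>\<D> S \<inter> \<D> (- S)\<close> consists of
  finite sets. There are only \<open>\<lambda>\<close> many pairs in \<open>\<D> S \<times> \<D> (- S)\<close>, so one can label them injectively
  by elements of \<open>\<lambda>\<close> and enlarge both components of each pair by its label. The enlarged pairs are
  still cofinal, but only finitely many of them lie below a given pair \<open>(C, K)\<close>, because their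
  labels belong to the finite set \<open>C \<inter> K\<close>. This is \<open>prod_has_finitely_op_like_base\<close>.

  Neither factor has such a base. A base gives, at one point, a cofinal subset of \<open>\<D> S\<close>, and for
  stationary \<open>S\<close> every cofinal subset of \<open>\<D> S\<close> has infinitely many members below a single
  \<open>K \<in> \<D> S\<close> (\<open>limit_ideal_cofinal_bounded\<close>). Any basic open set inside the neighbourhood given by \<open>K\<close>
  then has infinitely many supersets in the base (\<open>no_finitely_op_like_base\<close>).

  Thus the product has Noetherian type \<open>\<omega>\<close> and both factors have an uncountable one.
\<close>

section \<open>The topology given by an ideal of sets\<close>

definition cylinder :: "'a set \<Rightarrow> 'a set \<Rightarrow> 'a set \<Rightarrow> 'a set set" where
  "cylinder W A C = {B. B \<subseteq> W \<and> B \<inter> C = A \<inter> C}"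

definition ideal_topology :: "'a set set \<Rightarrow> 'a set topology" where
  "ideal_topology \<D> = topology (\<lambda>U. U \<subseteq> Pow (\<Union>\<D>) \<and> (\<forall>A\<in>U. \<exists>C\<in>\<D>. cylinder (\<Union>\<D>) A C \<subseteq> U))"

locale set_ideal =
  fixes \<D> :: "'a set set"
  assumes empty_mem: "{} \<in> \<D>"
    and Un_mem: "C \<in> \<D> \<Longrightarrow> K \<in> \<D> \<Longrightarrow> C \<union> K \<in> \<D>"
    and subset_mem: "K \<in> \<D> \<Longrightarrow> C \<subseteq> K \<Longrightarrow> C \<in> \<D>"
begin

lemma singleton_mem: "w \<in> \<Union>\<D> \<Longrightarrow> {w} \<in> \<D>"
  using subset_mem by blast

lemma openin_ideal_topology:
  "openin (ideal_topology \<D>) U \<longleftrightarrow>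
     U \<subseteq> Pow (\<Union>\<D>) \<and> (\<forall>A\<in>U. \<exists>C\<in>\<D>. cylinder (\<Union>\<D>) A C \<subseteq> U)"
proof -
  let ?P = "\<lambda>U. U \<subseteq> Pow (\<Union>\<D>) \<and> (\<forall>A\<in>U. \<exists>C\<in>\<D>. cylinder (\<Union>\<D>) A C \<subseteq> U)"
  have "istopology ?P"
    unfolding istopology_def
  proof (intro conjI allI impI)
    fix S T assume S: "?P S" and T: "?P T"
    show "S \<inter> T \<subseteq> Pow (\<Union>\<D>)" using S by blast
    show "\<forall>A\<in>S \<inter> T. \<exists>C\<in>\<D>. cylinder (\<Union>\<D>) A C \<subseteq> S \<inter> T"
    proof
      fix A assume A: "A \<in> S \<inter> T"
      obtain C where C: "C \<in> \<D>" "cylinder (\<Union>\<D>) A C \<subseteq> S"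
        using conjunct2[OF S] A by auto
      obtain K where K: "K \<in> \<D>" "cylinder (\<Union>\<D>) A K \<subseteq> T"
        using conjunct2[OF T] A by auto
      have "cylinder (\<Union>\<D>) A (C \<union> K) \<subseteq> cylinder (\<Union>\<D>) A C \<inter> cylinder (\<Union>\<D>) A K"
        unfolding cylinder_def by blast
      with C(2) K(2) have "cylinder (\<Union>\<D>) A (C \<union> K) \<subseteq> S \<inter> T" by blast
      with Un_mem[OF C(1) K(1)] show "\<exists>C\<in>\<D>. cylinder (\<Union>\<D>) A C \<subseteq> S \<inter> T" ..
    qed
  next
    fix \<K> assume *: "\<forall>S\<in>\<K>. ?P S"
    then show "\<Union>\<K> \<subseteq> Pow (\<Union>\<D>)" by (simp add: Sup_least)
    show "\<forall>A\<in>\<Union>\<K>. \<exists>C\<in>\<D>. cylinder (\<Union>\<D>) A C \<subseteq> \<Union>\<K>"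
    proof
      fix A assume "A \<in> \<Union>\<K>"
      then obtain S where S: "S \<in> \<K>" "A \<in> S" by (rule UnionE)
      with * obtain C where "C \<in> \<D>" "cylinder (\<Union>\<D>) A C \<subseteq> S" by meson
      with S show "\<exists>C\<in>\<D>. cylinder (\<Union>\<D>) A C \<subseteq> \<Union>\<K>" by (meson Union_upper order_trans)
    qed
  qed
  then show ?thesis
    unfolding ideal_topology_def by simp
qed

lemma topspace_ideal_topology: "topspace (ideal_topology \<D>) = Pow (\<Union>\<D>)"
proof -
  have "openin (ideal_topology \<D>) (Pow (\<Union>\<D>))"
    unfolding openin_ideal_topology cylinder_def using empty_mem by auto
  moreover have "topspace (ideal_topology \<D>) \<subseteq> Pow (\<Union>\<D>)"
    using openin_topspace[of "ideal_topology \<D>"] unfolding openin_ideal_topology ..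
  ultimately show ?thesis
    by (meson openin_subset subset_antisym)
qed

lemma openin_cylinder:
  assumes "C \<in> \<D>"
  shows "openin (ideal_topology \<D>) (cylinder (\<Union>\<D>) A C)"
  unfolding openin_ideal_topology
proof (intro conjI ballI)
  fix B assume "B \<in> cylinder (\<Union>\<D>) A C"
  then have "cylinder (\<Union>\<D>) B C \<subseteq> cylinder (\<Union>\<D>) A C" unfolding cylinder_def by auto
  with assms show "\<exists>K\<in>\<D>. cylinder (\<Union>\<D>) B K \<subseteq> cylinder (\<Union>\<D>) A C" ..
qed (auto simp: cylinder_def)

lemma closedin_cylinder:
  assumes "C \<in> \<D>"
  shows "closedin (ideal_topology \<D>) (cylinder (\<Union>\<D>) A C)"
  unfolding closedin_def topspace_ideal_topology openin_ideal_topology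
proof (intro conjI ballI)
  fix B assume "B \<in> Pow (\<Union>\<D>) - cylinder (\<Union>\<D>) A C"
  then have "cylinder (\<Union>\<D>) B C \<subseteq> Pow (\<Union>\<D>) - cylinder (\<Union>\<D>) A C"
    unfolding cylinder_def by auto
  with assms show "\<exists>K\<in>\<D>. cylinder (\<Union>\<D>) B K \<subseteq> Pow (\<Union>\<D>) - cylinder (\<Union>\<D>) A C" ..
qed (auto simp: cylinder_def)

lemma Tychonoff_ideal_topology: "Tychonoff_space (ideal_topology \<D>)"
proof -
  let ?X = "ideal_topology \<D>"
  have "completely_regular_space ?X"
    unfolding completely_regular_space_def
  proof (intro allI impI)
    fix S A assume *: "closedin ?X S \<and> A \<in> topspace ?X - S"
    then have "openin ?X (topspace ?X - S)" "A \<in> topspace ?X - S" by auto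
    then obtain C where C: "C \<in> \<D>" and sub: "cylinder (\<Union>\<D>) A C \<subseteq> topspace ?X - S"
      unfolding openin_ideal_topology by blast
    let ?V = "cylinder (\<Union>\<D>) A C"
    define f :: "'a set \<Rightarrow> real" where "f B = (if B \<in> ?V then 0 else 1)" for B
    have clopen: "openin ?X ?V" "openin ?X (topspace ?X - ?V)"
      using openin_cylinder closedin_cylinder C by blast+
    have "openin ?X {B \<in> topspace ?X. f B \<in> U}" for U
    proof -
      have "?V \<subseteq> topspace ?X" using clopen(1) openin_subset by blast
      then have "{B \<in> topspace ?X. f B \<in> U} =
          (if 0 \<in> U then ?V else {}) \<union> (if 1 \<in> U then topspace ?X - ?V else {})"
        unfolding f_def by auto
      then show ?thesis using clopen by auto
    qed
    then have "continuous_map ?X (top_of_set {0..1}) f"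
      unfolding continuous_map_in_subtopology by (auto simp: continuous_map_def f_def)
    moreover have "f A = 0"
      using * unfolding f_def cylinder_def topspace_ideal_topology by auto
    moreover have "f ` S \<subseteq> {1}"
      using sub unfolding f_def by auto
    ultimately show "\<exists>f. continuous_map ?X (top_of_set {0..1::real}) f \<and> f A = 0 \<and> f ` S \<subseteq> {1}"
      by blast
  qed
  moreover have "Hausdorff_space ?X"
    unfolding Hausdorff_space_def topspace_ideal_topology
  proof (intro allI impI)
    fix A B assume *: "A \<in> Pow (\<Union>\<D>) \<and> B \<in> Pow (\<Union>\<D>) \<and> A \<noteq> B"
    then obtain w where w: "w \<in> \<Union>\<D>" "\<not> (w \<in> A \<longleftrightarrow> w \<in> B)" by blast
    let ?U = "cylinder (\<Union>\<D>) A {w}" and ?V = "cylinder (\<Union>\<D>) B {w}"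
    have "openin ?X ?U" "openin ?X ?V" using openin_cylinder singleton_mem w by blast+
    moreover have "A \<in> ?U" "B \<in> ?V" using * unfolding cylinder_def by auto
    moreover have "disjnt ?U ?V" using w unfolding disjnt_def cylinder_def by auto
    ultimately show "\<exists>U V. openin ?X U \<and> openin ?X V \<and> A \<in> U \<and> B \<in> V \<and> disjnt U V"
      by blast
  qed
  ultimately show ?thesis unfolding Tychonoff_space_def ..
qed

text \<open>
  The members of a base that contain the empty set yield a cofinal subset of the ideal by choosing,
  for each of them, a member of the ideal whose cylinder it contains. A bound \<open>K\<close> of infinitely many
  of the chosen sets gives a neighbourhood contained in infinitely many members of the base.
\<close>

lemma no_finitely_op_like_base:
  assumes bounded: "\<And>\<Q>. \<Q> \<subseteq> \<D> \<Longrightarrow> \<forall>C\<in>\<D>. \<exists>K\<in>\<Q>. C \<subseteq> K \<Longrightarrow> \<exists>K\<in>\<D>. infinite {C \<in> \<Q>. C \<subseteq> K}"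
  shows "\<not> has_op_like_base (ideal_topology \<D>) natLeq"
proof
  let ?X = "ideal_topology \<D>" and ?W = "\<Union>\<D>"
  assume "has_op_like_base ?X natLeq"
  then obtain B where B: "base_of ?X B" and fin: "\<And>U. U \<in> B \<Longrightarrow> finite {V \<in> B. U \<subseteq> V}"
    unfolding has_op_like_base_def op_like_def finite_iff_ordLess_natLeq by blast
  have B_open: "openin ?X V" if "V \<in> B" for V
    using B that unfolding base_of_def openin_topology_base_unique by blast
  have B_nbhd: "\<exists>V\<in>B. A \<in> V \<and> V \<subseteq> U" if "openin ?X U" "A \<in> U" for U A
    using B that unfolding base_of_def openin_topology_base_unique by blast
  have "\<exists>C\<in>\<D>. cylinder ?W {} C \<subseteq> V" if "V \<in> B" "{} \<in> V" for V
    using B_open[OF that(1)] that(2) unfolding openin_ideal_topology by blast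
  then obtain c where c: "\<And>V. V \<in> B \<Longrightarrow> {} \<in> V \<Longrightarrow> c V \<in> \<D> \<and> cylinder ?W {} (c V) \<subseteq> V"
    by metis
  let ?Q = "c ` {V \<in> B. {} \<in> V}"
  have "\<exists>K\<in>?Q. C \<subseteq> K" if C: "C \<in> \<D>" for C
  proof -
    have "{} \<in> cylinder ?W {} C" unfolding cylinder_def by simp
    then obtain V where V: "V \<in> B" "{} \<in> V" "V \<subseteq> cylinder ?W {} C"
      using B_nbhd openin_cylinder[OF C] by blast
    have "x \<in> c V" if "x \<in> C" for x
    proof (rule ccontr)
      \<comment> \<open>The singleton of \<open>x\<close> cannot be told from the empty set by \<open>c V\<close>, but it can by \<open>C\<close>.\<close>
      assume "x \<notin> c V"
      then have "{x} \<in> cylinder ?W {} (c V)" using that C unfolding cylinder_def by auto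
      then have "{x} \<in> cylinder ?W {} C" using c V by blast
      with that show False unfolding cylinder_def by auto
    qed
    with V show ?thesis by blast
  qed
  moreover have "?Q \<subseteq> \<D>" using c by blast
  ultimately obtain K where K: "K \<in> \<D>" and inf: "infinite {C \<in> ?Q. C \<subseteq> K}"
    using bounded by meson
  have "{C \<in> ?Q. C \<subseteq> K} \<subseteq> c ` {V \<in> B. {} \<in> V \<and> c V \<subseteq> K}" by blast
  from inf finite_subset[OF this finite_imageI]
  have infV: "infinite {V \<in> B. {} \<in> V \<and> c V \<subseteq> K}" by (rule contrapos_nn)
  have "{} \<in> cylinder ?W {} K" unfolding cylinder_def by simp
  then obtain U where U: "U \<in> B" "U \<subseteq> cylinder ?W {} K"
    using B_nbhd openin_cylinder[OF K] by blast
  have "U \<subseteq> V" if "V \<in> B" "{} \<in> V" "c V \<subseteq> K" for V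
  proof -
    have "cylinder ?W {} K \<subseteq> cylinder ?W {} (c V)"
      using that(3) unfolding cylinder_def by blast
    with U c that show ?thesis by blast
  qed
  then have "{V \<in> B. {} \<in> V \<and> c V \<subseteq> K} \<subseteq> {V \<in> B. U \<subseteq> V}" by blast
  with infV fin[OF U(1)] show False using finite_subset by blast
qed

end

text \<open>
  Changing \<open>A\<close> at a point outside \<open>C\<close> does not leave the cylinder of \<open>A\<close> over \<open>C\<close>, so a larger
  cylinder cannot depend on that point. Hence inclusion of cylinders reverses inclusion in the ideal.
\<close>

lemma cylinder_subsetD:
  assumes sub: "cylinder W A C \<subseteq> cylinder W B K" and A: "A \<subseteq> W" and K: "K \<subseteq> W"
  shows "K \<subseteq> C" "B \<inter> K = A \<inter> K"
proof -
  have "A \<in> cylinder W A C" using A unfolding cylinder_def by auto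
  then show eq: "B \<inter> K = A \<inter> K" using sub unfolding cylinder_def by blast
  show "K \<subseteq> C"
  proof
    fix k assume k: "k \<in> K"
    show "k \<in> C"
    proof (rule ccontr)
      assume "k \<notin> C"
      define A' where "A' = (if k \<in> A then A - {k} else insert k A)"
      have "A' \<in> cylinder W A C"
        using A K k \<open>k \<notin> C\<close> unfolding A'_def cylinder_def by auto
      then have "A' \<inter> K = A \<inter> K" using sub eq unfolding cylinder_def by blast
      with k show False unfolding A'_def by (auto split: if_splits)
    qed
  qed
qed

text \<open>
  Adding the label \<open>\<iota> p\<close> to both components of the pair \<open>p\<close> makes it recoverable up to finitely
  many choices from any pair that lies above the enlarged one.
\<close>

lemma prod_has_finitely_op_like_base:
  assumes D: "set_ideal \<D>" and E: "set_ideal \<E>"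
    and W: "\<Union>\<D> = W" "\<Union>\<E> = W"
    and card: "|\<D> \<times> \<E>| \<le>o |W|"
    and orth: "\<And>C. C \<in> \<D> \<Longrightarrow> C \<in> \<E> \<Longrightarrow> finite C"
  shows "has_op_like_base (prod_topology (ideal_topology \<D>) (ideal_topology \<E>)) natLeq"
proof -
  interpret D: set_ideal \<D> by fact
  interpret E: set_ideal \<E> by fact
  obtain \<iota> where inj: "inj_on \<iota> (\<D> \<times> \<E>)" and im: "\<iota> ` (\<D> \<times> \<E>) \<subseteq> W"
    using card unfolding card_of_ordLeq[symmetric] by blast
  define q where "q p = (insert (\<iota> p) (fst p), insert (\<iota> p) (snd p))" for p
  have q: "fst (q p) \<in> \<D>" "snd (q p) \<in> \<E>" if "p \<in> \<D> \<times> \<E>" for p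
  proof -
    have "\<iota> p \<in> W" using im that by blast
    then have "{\<iota> p} \<in> \<D>" "{\<iota> p} \<in> \<E>" using D.singleton_mem E.singleton_mem W by auto
    then show "fst (q p) \<in> \<D>" "snd (q p) \<in> \<E>"
      using that D.Un_mem[of "{\<iota> p}" "fst p"] E.Un_mem[of "{\<iota> p}" "snd p"]
      unfolding q_def by auto
  qed
  define \<B> where "\<B> = {cylinder W A (fst (q p)) \<times> cylinder W B (snd (q p)) | A B p.
      A \<subseteq> W \<and> B \<subseteq> W \<and> p \<in> \<D> \<times> \<E>}"
  let ?XY = "prod_topology (ideal_topology \<D>) (ideal_topology \<E>)"
  have "base_of ?XY \<B>"
    unfolding base_of_def openin_topology_base_unique
  proof (intro conjI allI impI)
    fix V assume "V \<in> \<B>"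
    then show "openin ?XY V"
      unfolding \<B>_def
      using q D.openin_cylinder E.openin_cylinder W by (auto simp: openin_prod_Times_iff)
  next
    fix U z assume *: "openin ?XY U \<and> z \<in> U"
    obtain A B where z: "z = (A, B)" by (cases z)
    from * obtain P Q where P: "openin (ideal_topology \<D>) P" "A \<in> P"
      and Q: "openin (ideal_topology \<E>) Q" "B \<in> Q" and PQ: "P \<times> Q \<subseteq> U"
      unfolding z openin_prod_topology_alt by metis
    obtain C where C: "C \<in> \<D>" "cylinder W A C \<subseteq> P" and A: "A \<subseteq> W"
      using P unfolding D.openin_ideal_topology W by blast
    obtain K where K: "K \<in> \<E>" "cylinder W B K \<subseteq> Q" and B: "B \<subseteq> W"
      using Q unfolding E.openin_ideal_topology W by blast
    let ?p = "(C, K)"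
    let ?V = "cylinder W A (fst (q ?p)) \<times> cylinder W B (snd (q ?p))"
    have "?V \<in> \<B>" unfolding \<B>_def using A B C K by blast
    moreover have "z \<in> ?V" unfolding z cylinder_def using A B by auto
    moreover have "?V \<subseteq> cylinder W A C \<times> cylinder W B K"
      unfolding q_def cylinder_def by auto
    ultimately show "\<exists>V. V \<in> \<B> \<and> z \<in> V \<and> V \<subseteq> U" using C K PQ by blast
  qed
  moreover have "op_like natLeq \<B>"
    unfolding op_like_def finite_iff_ordLess_natLeq[symmetric]
  proof
    fix U assume "U \<in> \<B>"
    then obtain A B p where A: "A \<subseteq> W" and B: "B \<subseteq> W" and p: "p \<in> \<D> \<times> \<E>"
      and U: "U = cylinder W A (fst (q p)) \<times> cylinder W B (snd (q p))"
      unfolding \<B>_def by blast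
    define R where "R = {r \<in> \<D> \<times> \<E>. \<iota> r \<in> fst (q p) \<inter> snd (q p)}"
    have "finite (fst (q p) \<inter> snd (q p))"
      using orth q[OF p] D.subset_mem E.subset_mem by (meson inf_le1 inf_le2)
    moreover have "\<iota> ` R \<subseteq> fst (q p) \<inter> snd (q p)" "inj_on \<iota> R"
      using inj unfolding R_def by (auto intro: inj_on_subset)
    ultimately have "finite R" using inj_on_finite by blast
    let ?f = "\<lambda>r. cylinder W A (fst (q r)) \<times> cylinder W B (snd (q r))"
    have "{V \<in> \<B>. U \<subseteq> V} \<subseteq> ?f ` R"
    proof
      fix V assume "V \<in> {V \<in> \<B>. U \<subseteq> V}"
      then obtain A' B' r where r: "r \<in> \<D> \<times> \<E>" and UV: "U \<subseteq> V"
        and V: "V = cylinder W A' (fst (q r)) \<times> cylinder W B' (snd (q r))"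
        unfolding \<B>_def by blast
      have "A \<in> cylinder W A (fst (q p))" "B \<in> cylinder W B (snd (q p))"
        using A B unfolding cylinder_def by auto
      with UV have sub: "cylinder W A (fst (q p)) \<subseteq> cylinder W A' (fst (q r))"
        "cylinder W B (snd (q p)) \<subseteq> cylinder W B' (snd (q r))"
        unfolding U V by blast+
      have "fst (q r) \<subseteq> W" "snd (q r) \<subseteq> W" using q[OF r] W by blast+
      note 1 = cylinder_subsetD[OF sub(1) A this(1)] and 2 = cylinder_subsetD[OF sub(2) B this(2)]
      have "r \<in> R" using 1(1) 2(1) r unfolding R_def q_def by auto
      moreover have "V = ?f r" unfolding V cylinder_def using 1(2) 2(2) by auto
      ultimately show "V \<in> ?f ` R" by blast
    qed
    with \<open>finite R\<close> show "finite {V \<in> \<B>. U \<subseteq> V}" using finite_surj by blast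
  qed
  ultimately show ?thesis unfolding has_op_like_base_def by blast
qed

lemma natLeq_less_Nt:
  assumes "\<not> has_op_like_base X natLeq"
  shows "natLeq <o Nt X"
proof (rule ccontr)
  have N: "Well_order (Nt X)" "has_op_like_base X (Nt X)"
    using Nt_is_Noetherian_type[of X] unfolding is_Noetherian_type_def
    by (auto dest: card_order_on_well_order_on)
  assume "\<not> natLeq <o Nt X"
  then have "Nt X \<le>o natLeq"
    using not_ordLess_iff_ordLeq[OF N(1) natLeq_Well_order] by blast
  with N(2) assms show False using has_op_like_base_mono by blast
qed

section \<open>The successor of the continuum\<close>

text \<open>
  The type \<open>'a suc\<close> carries the successor cardinal of the cardinality of \<open>'a\<close>, and its canonical
  well-order makes it an instance of the class of well-orders. Its elements are represented by
  subsets of \<open>'a\<close>; for \<open>real suc\<close> this places the ground set inside \<open>real set\<close>, and it also serves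
  to separate points when the stationary set is split.
\<close>

instantiation suc :: (type) wellorder
begin

definition less_eq_suc :: "'a suc \<Rightarrow> 'a suc \<Rightarrow> bool" where
  "less_eq_suc a b \<longleftrightarrow> (a, b) \<in> card_suc |UNIV :: 'a set|"

definition less_suc :: "'a suc \<Rightarrow> 'a suc \<Rightarrow> bool" where
  "less_suc a b \<longleftrightarrow> a \<le> b \<and> a \<noteq> b"

instance
proof -
  let ?r = "card_suc |UNIV :: 'a set|"
  have "well_order_on UNIV ?r"
    using card_order_card_suc[OF card_of_card_order_on] card_order_on_well_order_on by blast
  then have refl: "\<And>a. (a, a) \<in> ?r" and trans: "trans ?r" and antisym: "antisym ?r"
    and total: "total ?r" and wf: "wf (?r - Id)"
    unfolding well_order_on_def linear_order_on_def partial_order_on_def preorder_on_def refl_on_def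
    by blast+
  show "OFCLASS('a suc, wellorder_class)"
  proof
    fix a b c :: "'a suc"
    show "a < b \<longleftrightarrow> a \<le> b \<and> \<not> b \<le> a"
      using antisym refl unfolding less_suc_def less_eq_suc_def antisym_def by blast
    show "a \<le> a" using refl unfolding less_eq_suc_def .
    show "a \<le> c" if "a \<le> b" "b \<le> c" using that trans unfolding less_eq_suc_def trans_def by blast
    show "a = b" if "a \<le> b" "b \<le> a" using that antisym unfolding less_eq_suc_def antisym_def by blast
    show "a \<le> b \<or> b \<le> a" using total refl unfolding less_eq_suc_def total_on_def
      by (cases "a = b") simp_all
    fix P :: "'a suc \<Rightarrow> bool"
    assume step: "\<And>x. (\<And>y. y < x \<Longrightarrow> P y) \<Longrightarrow> P x"
    show "P a"
      by (rule wf_induct[OF wf]) (use step in \<open>auto simp: less_suc_def less_eq_suc_def\<close>)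
  qed
qed

end

lemma card_lessThan_suc: "|{..<a}| \<le>o |UNIV :: 'a set|" for a :: "'a suc"
proof -
  let ?r = "card_suc |UNIV :: 'a set|"
  have "{..<a} = underS ?r a"
    unfolding underS_def by (auto simp: less_suc_def less_eq_suc_def)
  moreover have "|underS ?r a| <o ?r"
    by (rule card_of_underS)
      (simp_all add: Field_card_suc card_order_card_suc[OF card_of_card_order_on])
  ultimately have "|{..<a}| <o cardSuc |UNIV :: 'a set|"
    using cardSuc_ordIso_card_suc[OF card_of_card_order_on] ordIso_symmetric ordLess_ordIso_trans
    by metis
  then show ?thesis
    by (simp add: cardSuc_ordLeq_ordLess card_of_Card_order)
qed

lemma card_UNIV_suc: "|UNIV :: 'a set| <o |UNIV :: 'a suc set|"
proof -
  let ?r = "card_suc |UNIV :: 'a set|"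
  have "|UNIV :: 'a set| <o ?r" by (simp add: card_suc_greater card_of_card_order_on)
  moreover have "?r =o |UNIV :: 'a suc set|"
    using ordIso_symmetric[OF card_of_Field_ordIso[OF Card_order_card_suc]] card_of_card_order_on
    unfolding Field_card_suc by blast
  ultimately show ?thesis by (rule ordLess_ordIso_trans)
qed

abbreviation small :: "'a set \<Rightarrow> bool" where
  "small A \<equiv> |A| \<le>o |UNIV :: real set|"

lemma small_subset: "A \<subseteq> B \<Longrightarrow> small B \<Longrightarrow> small A"
  by (rule ordLeq_transitive[OF card_of_mono1])

lemma small_image: "small A \<Longrightarrow> small (f ` A)"
  by (rule ordLeq_transitive[OF card_of_image])

lemma small_UN: "small I \<Longrightarrow> (\<And>i. i \<in> I \<Longrightarrow> small (A i)) \<Longrightarrow> small (\<Union>i\<in>I. A i)"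
  by (rule card_of_UNION_ordLeq_infinite) (simp_all add: infinite_UNIV_char_0)

lemma small_countable:
  assumes "countable A"
  shows "small A"
proof -
  obtain f :: "_ \<Rightarrow> nat" where "inj_on f A" using assms by (rule countableE)
  then have "inj_on (real \<circ> f) A" by (simp add: inj_on_def)
  then show ?thesis by (rule card_of_ordLeqI) simp
qed

lemma small_insert:
  assumes "small A"
  shows "small (insert x A)"
proof -
  have "insert x A = (\<Union>b. if b then {x} else A)" by (auto simp: UNIV_bool)
  moreover have "small (\<Union>b. if b then {x} else A)"
    using assms by (intro small_UN) (auto simp: small_countable)
  ultimately show ?thesis by simp
qed

text \<open>
  This is where the continuum enters: \<open>\<kappa>\<^sup>\<omega> = \<kappa>\<close> holds for it because a sequence of sets of naturals
  is coded by a single set of pairs of naturals.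
\<close>

lemma small_countable_subsets:
  assumes "small B"
  shows "small {C. countable C \<and> C \<subseteq> B}"
proof -
  obtain g :: "real \<Rightarrow> nat set" where g: "inj g"
    using nat_sets_eqpoll_reals eqpoll_imp_lepoll eqpoll_sym unfolding lepoll_def by blast
  obtain k :: "nat set \<Rightarrow> real" where k: "inj k"
    using nat_sets_eqpoll_reals eqpoll_imp_lepoll unfolding lepoll_def by blast
  define code where "code f = k (prod_encode ` (SIGMA n:UNIV. g (f n)))" for f :: "nat \<Rightarrow> real"
  have "inj code"
  proof
    fix f f' :: "nat \<Rightarrow> real" assume "code f = code f'"
    then have "(SIGMA n:UNIV. g (f n)) = (SIGMA n:UNIV. g (f' n))"
      unfolding code_def using k inj_prod_encode[of UNIV] by (simp add: inj_eq inj_image_eq_iff)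
    then have "(SIGMA n:UNIV. g (f n)) `` {n} = (SIGMA n:UNIV. g (f' n)) `` {n}" for n by simp
    then have "g (f n) = g (f' n)" for n unfolding Sigma_Image by simp
    then show "f = f'" using g by (auto simp: inj_eq)
  qed
  then have seq: "small (UNIV :: (nat \<Rightarrow> real) set)"
    by (rule card_of_ordLeqI) simp
  obtain h :: "_ \<Rightarrow> real" where h: "inj_on h B"
    using assms unfolding card_of_ordLeq[symmetric] by blast
  define dec where "dec f = inv_into B h ` range f" for f :: "nat \<Rightarrow> real"
  have "C \<in> range dec" if C: "countable C" "C \<subseteq> B" "C \<noteq> {}" for C
  proof
    have "range (\<lambda>n. h (from_nat_into C n)) = h ` C"
      using range_from_nat_into[OF C(3,1)] by (simp flip: image_image)
    then show "C = dec (\<lambda>n. h (from_nat_into C n))"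
      unfolding dec_def using h C(2) by (simp add: inv_into_image_cancel)
  qed simp
  then have "{C. countable C \<and> C \<subseteq> B} \<subseteq> insert {} (range dec)" by blast
  then show ?thesis by (rule small_subset) (rule small_insert[OF small_image[OF seq]])
qed

text \<open>Regularity of the successor cardinal, in the form in which it is used.\<close>

lemma small_bounded:
  fixes A :: "real suc set"
  assumes "small A"
  obtains b where "\<And>a. a \<in> A \<Longrightarrow> a < b"
proof -
  have "small {..a}" for a :: "real suc"
  proof -
    have "{..a} = insert a {..<a}" by auto
    then show ?thesis using small_insert card_lessThan_suc by metis
  qed
  then have "small (\<Union>a\<in>A. {..a})" using assms by (intro small_UN)
  then have "(\<Union>a\<in>A. {..a}) \<noteq> UNIV"
    using card_UNIV_suc[where 'a = real] not_ordLess_ordLeq by metis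
  then obtain b where "b \<notin> (\<Union>a\<in>A. {..a})" by blast
  then show ?thesis by (intro that[of b]) (simp add: not_le)
qed

lemma infinite_UNIV_real_suc: "infinite (UNIV :: real suc set)"
  by (rule card_of_ordLeq_infinite[OF ordLess_imp_ordLeq[OF card_UNIV_suc[where 'a = real]]
        infinite_UNIV_char_0])

lemma card_countable_sets: "|{C :: real suc set. countable C}| \<le>o |UNIV :: real suc set|"
proof -
  have "{C :: real suc set. countable C} \<subseteq> (\<Union>b. {C. countable C \<and> C \<subseteq> {..<b}})"
  proof
    fix C :: "real suc set" assume C: "C \<in> {C. countable C}"
    then obtain b where "\<And>a. a \<in> C \<Longrightarrow> a < b"
      using small_bounded[OF small_countable] by blast
    with C show "C \<in> (\<Union>b. {C. countable C \<and> C \<subseteq> {..<b}})" by blast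
  qed
  moreover have "|\<Union>b :: real suc. {C. countable C \<and> C \<subseteq> {..<b}}| \<le>o |UNIV :: real suc set|"
  proof (rule card_of_UNION_ordLeq_infinite)
    show "\<forall>b :: real suc\<in>UNIV. |{C. countable C \<and> C \<subseteq> {..<b}}| \<le>o |UNIV :: real suc set|"
      using ordLess_imp_ordLeq[OF
          ordLeq_ordLess_trans[OF small_countable_subsets[OF card_lessThan_suc] card_UNIV_suc]] by blast
  qed (simp_all add: infinite_UNIV_real_suc card_of_mono1)
  ultimately show ?thesis by (rule ordLeq_transitive[OF card_of_mono1])
qed

section \<open>Stationary sets and their ideals\<close>

definition climbs :: "(nat \<Rightarrow> 'a::wellorder) \<Rightarrow> 'a \<Rightarrow> bool" where
  "climbs f \<delta> \<longleftrightarrow> strict_mono f \<and> (\<forall>n. f n < \<delta>) \<and> (\<forall>a<\<delta>. \<exists>n. a < f n)"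

text \<open>
  The sets \<open>C\<close> need not be closed themselves: asking only where their limits lie makes the family
  closed under subsets.
\<close>

definition limit_ideal :: "'a::wellorder set \<Rightarrow> 'a set set" where
  "limit_ideal S = {C. countable C \<and> (\<forall>f \<delta>. range f \<subseteq> C \<and> climbs f \<delta> \<longrightarrow> \<delta> \<in> S)}"

text \<open>
  The points closed under a function form a club, and every club contains such a set; so this is
  stationarity in the sense of meeting every club in a point of cofinality \<open>\<omega>\<close>.
\<close>

definition stationary :: "'a::wellorder set \<Rightarrow> bool" where
  "stationary S \<longleftrightarrow> (\<forall>F. \<exists>\<delta>\<in>S. (\<exists>f. climbs f \<delta>) \<and> (\<forall>a<\<delta>. F a < \<delta>))"

lemma climbs_subseq:
  assumes "climbs f \<delta>" "strict_mono r"
  shows "climbs (f \<circ> r) \<delta>"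
  unfolding climbs_def
proof (intro conjI allI impI)
  show "strict_mono (f \<circ> r)" using assms strict_mono_o unfolding climbs_def by blast
  show "(f \<circ> r) n < \<delta>" for n using assms unfolding climbs_def by simp
  fix a assume "a < \<delta>"
  then obtain n where "a < f n" using assms unfolding climbs_def by blast
  also have "f n \<le> f (r n)"
    using assms seq_suble[of r n] unfolding climbs_def by (simp add: strict_mono_less_eq)
  finally show "\<exists>n. a < (f \<circ> r) n" by auto
qed

text \<open>One of the two sets contains infinitely many terms of the sequence, and a subsequence has the
  same limit.\<close>

lemma limit_ideal_Un:
  assumes C: "C \<in> limit_ideal S" and K: "K \<in> limit_ideal S"
  shows "C \<union> K \<in> limit_ideal S"
proof -
  have "\<delta> \<in> S" if f: "range f \<subseteq> C \<union> K" "climbs f \<delta>" for f \<delta>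
  proof -
    have "{n. f n \<in> C} \<union> {n. f n \<in> K} = UNIV" using f(1) by auto
    then consider "infinite {n. f n \<in> C}" | "infinite {n. f n \<in> K}"
      by (metis finite_Un infinite_UNIV_nat)
    then obtain J where J: "infinite {n. f n \<in> J}" "J \<in> limit_ideal S"
      using C K by cases
    then obtain r :: "nat \<Rightarrow> nat" where r: "strict_mono r" "\<And>n. f (r n) \<in> J"
      using infinite_enumerate[OF J(1)] by auto
    then have "range (f \<circ> r) \<subseteq> J" by auto
    with J(2) climbs_subseq[OF f(2) r(1)] show ?thesis unfolding limit_ideal_def by blast
  qed
  with C K show ?thesis unfolding limit_ideal_def by auto
qed

lemma limit_ideal_finite:
  assumes "finite C"
  shows "C \<in> limit_ideal S"
proof -
  have False if "range f \<subseteq> C" "climbs f \<delta>" for f \<delta>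
    using that assms strict_mono_imp_inj_on[of f] finite_subset[of "range f" C]
      range_inj_infinite[of f]
    unfolding climbs_def by blast
  with assms show ?thesis unfolding limit_ideal_def by (auto intro: countable_finite)
qed

lemma set_ideal_limit_ideal: "set_ideal (limit_ideal S)"
proof
  show "C \<in> limit_ideal S" if "K \<in> limit_ideal S" "C \<subseteq> K" for C K
    using that countable_subset[of C K] order_trans[of _ C K] unfolding limit_ideal_def by blast
qed (simp_all add: limit_ideal_finite limit_ideal_Un)

lemma climbs_exists:
  fixes f :: "nat \<Rightarrow> real suc"
  assumes "strict_mono f"
  obtains \<delta> where "climbs f \<delta>"
proof -
  obtain b where b: "\<And>a. a \<in> range f \<Longrightarrow> a < b"
    using small_bounded[OF small_countable, of "range f"] by auto
  define \<delta> where "\<delta> = (LEAST b. \<forall>n. f n < b)"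
  have "\<forall>n. f n < \<delta>" unfolding \<delta>_def by (rule LeastI[of _ b]) (use b in blast)
  moreover have "\<exists>n. a < f n" if "a < \<delta>" for a
  proof -
    obtain n where "a \<le> f n"
      using not_less_Least[of a "\<lambda>b. \<forall>n. f n < b"] \<open>a < \<delta>\<close> unfolding \<delta>_def
      by (auto simp: not_less)
    then show ?thesis using assms strict_monoD[of f n "Suc n"] by (meson lessI le_less_trans)
  qed
  ultimately have "climbs f \<delta>" using assms unfolding climbs_def by blast
  then show ?thesis by (rule that)
qed

lemma limit_ideals_orthogonal:
  fixes C :: "real suc set"
  assumes "C \<in> limit_ideal S" "C \<in> limit_ideal (- S)"
  shows "finite C"
proof (rule ccontr)
  assume inf: "infinite C"
  then have "strict_mono (enumerate C)" "range (enumerate C) \<subseteq> C"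
    using enumerate_step[OF inf] enumerate_in_set[OF inf] by (auto simp: strict_mono_Suc_iff)
  moreover then obtain \<delta> where "climbs (enumerate C) \<delta>" using climbs_exists by blast
  ultimately show False using assms unfolding limit_ideal_def by blast
qed

lemma closure_points_unbounded:
  fixes F :: "real suc \<Rightarrow> real suc"
  obtains \<delta> f where "a < \<delta>" "climbs f \<delta>" "\<And>b. b < \<delta> \<Longrightarrow> F b < \<delta>"
proof -
  have "\<exists>y. x < y \<and> (\<forall>b<x. F b < y)" for x
  proof -
    have "small (insert x (F ` {..<x}))"
      by (intro small_insert small_image card_lessThan_suc)
    then obtain y where "\<And>z. z \<in> insert x (F ` {..<x}) \<Longrightarrow> z < y" using small_bounded by blast
    then show ?thesis by auto
  qed
  then obtain G where G: "\<And>x. x < G x" "\<And>x b. b < x \<Longrightarrow> F b < G x" by metis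
  define f where "f n = (G ^^ Suc n) a" for n
  have "strict_mono f" unfolding strict_mono_Suc_iff f_def using G(1) by simp
  then obtain \<delta> where \<delta>: "climbs f \<delta>" using climbs_exists by blast
  show ?thesis
  proof
    have "a < f 0" unfolding f_def using G(1) by simp
    also have "f 0 < \<delta>" using \<delta> unfolding climbs_def by blast
    finally show "a < \<delta>" .
    fix b assume "b < \<delta>"
    then obtain n where "b < f n" using \<delta> unfolding climbs_def by blast
    then have "F b < f (Suc n)" using G(2) unfolding f_def by simp
    also have "\<dots> < \<delta>" using \<delta> unfolding climbs_def by blast
    finally show "F b < \<delta>" .
  qed (fact \<delta>)
qed

text \<open>
  For a real \<open>x\<close> consider the set of all ordinals \<open>\<delta>\<close> whose representing set of reals contains \<open>x\<close>.
  If for each \<open>x\<close> this set or its complement were nonstationary, then on a club depending on \<open>x\<close> all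
  points of cofinality \<open>\<omega>\<close> would agree about \<open>x\<close>. The intersection of continuum many clubs is a club,
  and two different points of it would agree about all reals, so they would have the same
  representing set.
\<close>

lemma stationary_split:
  obtains S :: "real suc set" where "stationary S" "stationary (- S)"
proof (rule ccontr)
  assume "\<not> thesis"
  with that have "\<not> stationary {\<delta>. x \<in> Rep_suc \<delta>} \<or> \<not> stationary (- {\<delta>. x \<in> Rep_suc \<delta>})"
    for x :: real by blast
  then have "\<exists>F. (\<forall>\<delta> f. climbs f \<delta> \<and> (\<forall>a<\<delta>. F a < \<delta>) \<longrightarrow> x \<notin> Rep_suc \<delta>) \<or>
      (\<forall>\<delta> f. climbs f \<delta> \<and> (\<forall>a<\<delta>. F a < \<delta>) \<longrightarrow> x \<in> Rep_suc \<delta>)" for x :: real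
    unfolding stationary_def by (metis Compl_iff mem_Collect_eq)
  then obtain F :: "real \<Rightarrow> real suc \<Rightarrow> real suc"
    where F: "\<And>x. (\<forall>\<delta> f. climbs f \<delta> \<and> (\<forall>a<\<delta>. F x a < \<delta>) \<longrightarrow> x \<notin> Rep_suc \<delta>) \<or>
      (\<forall>\<delta> f. climbs f \<delta> \<and> (\<forall>a<\<delta>. F x a < \<delta>) \<longrightarrow> x \<in> Rep_suc \<delta>)" by metis
  have "\<exists>b. \<forall>x. F x a < b" for a
  proof -
    have "small (range (\<lambda>x. F x a))" by (rule card_of_image)
    then obtain b where "\<And>y. y \<in> range (\<lambda>x. F x a) \<Longrightarrow> y < b"
      using small_bounded by blast
    then show ?thesis by auto
  qed
  then obtain G where G: "\<And>x a. F x a < G a" by metis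
  obtain \<delta> f where \<delta>: "climbs f \<delta>" "\<And>b. b < \<delta> \<Longrightarrow> G b < \<delta>"
    using closure_points_unbounded[of undefined G] by blast
  obtain \<delta>' f' where \<delta>': "\<delta> < \<delta>'" "climbs f' \<delta>'" "\<And>b. b < \<delta>' \<Longrightarrow> G b < \<delta>'"
    using closure_points_unbounded[of \<delta> G] by blast
  have "\<forall>a<\<delta>. F x a < \<delta>" "\<forall>a<\<delta>'. F x a < \<delta>'" for x
    using G \<delta>(2) \<delta>'(3) less_trans by blast+
  then have "x \<in> Rep_suc \<delta> \<longleftrightarrow> x \<in> Rep_suc \<delta>'" for x
    using F[of x] \<delta>(1) \<delta>'(2) by meson
  then have "\<delta> = \<delta>'" by (simp add: set_eq_iff flip: Rep_suc_inject)
  with \<delta>'(1) show False by simp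
qed

text \<open>
  Choose \<open>C \<xi> \<in> \<Q>\<close> containing \<open>\<xi>\<close>. Below a fixed \<open>\<gamma>\<close> there are at most continuum many traces
  \<open>C \<xi> \<inter> {..<\<gamma>}\<close>, so each trace with \<open>\<xi> > \<gamma>\<close> is realised by a \<open>\<xi>' > \<gamma>\<close> with \<open>C \<xi>'\<close> below a bound
  \<open>F \<gamma>\<close>. Let \<open>\<delta> \<in> S\<close> be closed under \<open>F\<close> and let \<open>f\<close> climb to \<open>\<delta>\<close>. For each \<open>n\<close> the trace of \<open>C \<delta>\<close>
  on \<open>{..<f n}\<close> is the trace of some \<open>C (\<xi> n)\<close> bounded strictly below \<open>\<delta>\<close> with \<open>f n < \<xi> n\<close>. The
  union of these sets belongs to the ideal: below \<open>f m\<close> it is covered by \<open>C \<delta>\<close> and finitely many of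
  the \<open>C (\<xi> n)\<close>, so its only possible new limit is \<open>\<delta>\<close>, which lies in \<open>S\<close>.
\<close>

lemma limit_ideal_cofinal_bounded:
  fixes S :: "real suc set"
  assumes S: "stationary S" and Q: "\<Q> \<subseteq> limit_ideal S"
    and cofinal: "\<forall>C\<in>limit_ideal S. \<exists>K\<in>\<Q>. C \<subseteq> K"
  shows "\<exists>K\<in>limit_ideal S. infinite {C \<in> \<Q>. C \<subseteq> K}"
proof -
  have "\<exists>K\<in>\<Q>. \<xi> \<in> K" for \<xi>
    using cofinal limit_ideal_finite[of "{\<xi>}" S] by auto
  then obtain C where C: "\<And>\<xi>. C \<xi> \<in> \<Q>" "\<And>\<xi>. \<xi> \<in> C \<xi>" by metis
  have C_ideal: "C \<xi> \<in> limit_ideal S" for \<xi> using C(1) Q by blast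
  then have C_countable: "countable (C \<xi>)" for \<xi> unfolding limit_ideal_def by blast
  have "\<exists>b. \<forall>\<xi>>\<gamma>. \<exists>\<xi>'>\<gamma>. C \<xi>' \<inter> {..<\<gamma>} = C \<xi> \<inter> {..<\<gamma>} \<and> C \<xi>' \<subseteq> {..<b}" for \<gamma>
  proof -
    let ?T = "(\<lambda>\<xi>. C \<xi> \<inter> {..<\<gamma>}) ` {\<gamma><..}"
    have "?T \<subseteq> {A. countable A \<and> A \<subseteq> {..<\<gamma>}}" using C_countable by auto
    then have T: "small ?T"
      using small_subset small_countable_subsets[OF card_lessThan_suc] by blast
    have "\<forall>A\<in>?T. \<exists>\<xi>>\<gamma>. C \<xi> \<inter> {..<\<gamma>} = A" by auto
    then obtain rep where rep: "\<And>A. A \<in> ?T \<Longrightarrow> \<gamma> < rep A \<and> C (rep A) \<inter> {..<\<gamma>} = A" by metis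
    have "small (\<Union>A\<in>?T. C (rep A))"
      by (rule small_UN[OF T]) (rule small_countable[OF C_countable])
    then obtain b where b: "\<And>a. a \<in> (\<Union>A\<in>?T. C (rep A)) \<Longrightarrow> a < b" using small_bounded by blast
    have "\<exists>\<xi>'>\<gamma>. C \<xi>' \<inter> {..<\<gamma>} = C \<xi> \<inter> {..<\<gamma>} \<and> C \<xi>' \<subseteq> {..<b}" if "\<xi> > \<gamma>" for \<xi>
    proof -
      have "C \<xi> \<inter> {..<\<gamma>} \<in> ?T" using that by blast
      with rep b show ?thesis by (meson UN_I lessThan_iff subsetI)
    qed
    then show ?thesis by blast
  qed
  then obtain F where F: "\<And>\<gamma> \<xi>. \<gamma> < \<xi> \<Longrightarrow>
      \<exists>\<xi>'>\<gamma>. C \<xi>' \<inter> {..<\<gamma>} = C \<xi> \<inter> {..<\<gamma>} \<and> C \<xi>' \<subseteq> {..<F \<gamma>}" by metis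
  obtain \<delta> f where "\<delta> \<in> S" and f: "climbs f \<delta>" and \<delta>: "\<And>a. a < \<delta> \<Longrightarrow> F a < \<delta>"
    using S unfolding stationary_def by metis
  have f_less: "f n < \<delta>" and f_mono: "strict_mono f" and f_cof: "a < \<delta> \<Longrightarrow> \<exists>n. a < f n" for n a
    using f unfolding climbs_def by auto
  have "\<forall>n. \<exists>\<xi>>f n. C \<xi> \<inter> {..<f n} = C \<delta> \<inter> {..<f n} \<and> C \<xi> \<subseteq> {..<F (f n)}"
    using F[OF f_less] by blast
  then obtain \<xi> where \<xi>: "\<And>n. f n < \<xi> n" "\<And>n. C (\<xi> n) \<inter> {..<f n} = C \<delta> \<inter> {..<f n}"
    "\<And>n. C (\<xi> n) \<subseteq> {..<F (f n)}" by metis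
  define K where "K = (\<Union>n. C (\<xi> n))"
  have K_less: "a < \<delta>" if "a \<in> K" for a
    using that \<xi>(3) \<delta>[OF f_less] unfolding K_def by (meson UN_E lessThan_iff less_trans subsetD)
  have "K \<in> limit_ideal S"
    unfolding limit_ideal_def mem_Collect_eq
  proof (intro conjI allI impI)
    show "countable K" unfolding K_def using C_countable by simp
    fix g \<eta> assume g: "range g \<subseteq> K \<and> climbs g \<eta>"
    show "\<eta> \<in> S"
    proof (cases "\<eta> < \<delta>")
      case True
      then obtain m where m: "\<eta> < f m" using f_cof by blast
      have "(\<Union>n<k. C (\<xi> n)) \<in> limit_ideal S" for k
        by (induction k) (auto simp: lessThan_Suc limit_ideal_finite limit_ideal_Un C_ideal)
      then have ideal: "C \<delta> \<union> (\<Union>n<m. C (\<xi> n)) \<in> limit_ideal S"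
        using C_ideal limit_ideal_Un by blast
      have "range g \<subseteq> C \<delta> \<union> (\<Union>n<m. C (\<xi> n))"
      proof clarify
        fix i assume *: "g i \<notin> (\<Union>n<m. C (\<xi> n))"
        obtain n where n: "g i \<in> C (\<xi> n)" using g unfolding K_def by blast
        with * have "m \<le> n" by (metis UN_I lessThan_iff not_less)
        moreover have "g i < f m" using g m unfolding climbs_def by (meson less_trans)
        ultimately have "g i < f n" using f_mono by (meson strict_mono_less_eq less_le_trans)
        with n \<xi>(2)[of n] show "g i \<in> C \<delta>" by blast
      qed
      with ideal g show ?thesis unfolding limit_ideal_def by blast
    next
      case False
      have "g i < \<delta>" for i using K_less g by blast
      then have "\<not> \<delta> < \<eta>" using g unfolding climbs_def by (meson not_less_iff_gr_or_eq)
      with False \<open>\<delta> \<in> S\<close> show ?thesis by (metis neq_iff)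
    qed
  qed
  moreover have "infinite {C \<in> \<Q>. C \<subseteq> K}"
  proof
    assume "finite {C \<in> \<Q>. C \<subseteq> K}"
    moreover have "range (\<lambda>n. C (\<xi> n)) \<subseteq> {C \<in> \<Q>. C \<subseteq> K}" using C(1) unfolding K_def by blast
    ultimately have "finite (range (\<lambda>n. C (\<xi> n)))" using finite_subset by blast
    \<comment> \<open>A set that occurs infinitely often would be bounded below \<open>\<delta>\<close> and contain points arbitrarily
      close to \<open>\<delta>\<close>.\<close>
    then obtain m where m: "infinite {n. C (\<xi> n) = C (\<xi> m)}"
      using pigeonhole_infinite[of UNIV "\<lambda>n. C (\<xi> n)"] by auto
    obtain k where k: "F (f m) < f k" using f_cof \<delta> f_less by blast
    obtain n where n: "k \<le> n" "C (\<xi> n) = C (\<xi> m)"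
      using m unfolding infinite_nat_iff_unbounded_le by blast
    have "\<xi> n < F (f m)" using C(2)[of "\<xi> n"] n(2) \<xi>(3)[of m] by auto
    also have "\<dots> < f k" by (fact k)
    also have "\<dots> \<le> f n" using f_mono n(1) by (simp add: strict_mono_less_eq)
    also have "\<dots> < \<xi> n" by (fact \<xi>(1))
    finally show False .
  qed
  ultimately show ?thesis by blast
qed

section \<open>The two spaces\<close>

lemma set_ideal_image:
  assumes "set_ideal \<D>"
  shows "set_ideal ((`) h ` \<D>)"
proof -
  interpret set_ideal \<D> by fact
  show ?thesis
  proof
    show "{} \<in> (`) h ` \<D>" using imageI[OF empty_mem, of "(`) h"] by simp
    show "C \<union> K \<in> (`) h ` \<D>" if C: "C \<in> (`) h ` \<D>" and K: "K \<in> (`) h ` \<D>" for C K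
    proof -
      obtain C' where "C = h ` C'" "C' \<in> \<D>" using C by (rule imageE)
      moreover obtain K' where "K = h ` K'" "K' \<in> \<D>" using K by (rule imageE)
      ultimately show ?thesis using Un_mem by (simp flip: image_Un)
    qed
    show "C \<in> (`) h ` \<D>" if K: "K \<in> (`) h ` \<D>" and sub: "C \<subseteq> K" for C K
    proof -
      obtain K' where K': "K = h ` K'" "K' \<in> \<D>" using K by (rule imageE)
      with sub obtain C' where "C' \<subseteq> K'" "C = h ` C'" by (auto simp: subset_image_iff)
      then show ?thesis using subset_mem K'(2) by blast
    qed
  qed
qed

lemma cofinal_bounded_image:
  assumes bounded: "\<And>\<Q>. \<Q> \<subseteq> \<D> \<Longrightarrow> \<forall>C\<in>\<D>. \<exists>K\<in>\<Q>. C \<subseteq> K \<Longrightarrow> \<exists>K\<in>\<D>. infinite {C \<in> \<Q>. C \<subseteq> K}"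
    and h: "inj h" and R: "\<R> \<subseteq> (`) h ` \<D>"
    and cofinal: "\<forall>C\<in>(`) h ` \<D>. \<exists>K\<in>\<R>. C \<subseteq> K"
  shows "\<exists>K\<in>(`) h ` \<D>. infinite {C \<in> \<R>. C \<subseteq> K}"
proof -
  define \<Q> where "\<Q> = {C \<in> \<D>. h ` C \<in> \<R>}"
  have "\<exists>K\<in>\<Q>. C \<subseteq> K" if C: "C \<in> \<D>" for C
  proof -
    obtain K where K: "K \<in> \<R>" "h ` C \<subseteq> K" using cofinal C by blast
    then obtain K' where "K' \<in> \<D>" "K = h ` K'" using R by blast
    with K h show ?thesis unfolding \<Q>_def by (auto simp: inj_image_subset_iff)
  qed
  moreover have "\<Q> \<subseteq> \<D>" unfolding \<Q>_def by blast
  ultimately obtain K where K: "K \<in> \<D>" "infinite {C \<in> \<Q>. C \<subseteq> K}" using bounded by meson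
  have "inj_on ((`) h) {C \<in> \<Q>. C \<subseteq> K}" using h by (simp add: inj_on_def inj_image_eq_iff)
  then have "infinite ((`) h ` {C \<in> \<Q>. C \<subseteq> K})" using K(2) finite_imageD by blast
  moreover have "(`) h ` {C \<in> \<Q>. C \<subseteq> K} \<subseteq> {C \<in> \<R>. C \<subseteq> h ` K}" unfolding \<Q>_def by blast
  ultimately have "infinite {C \<in> \<R>. C \<subseteq> h ` K}" using finite_subset by blast
  with K(1) show ?thesis by blast
qed

theorem mainTheorem1:
  shows "\<exists>X Y :: real set set topology.
    Tychonoff_space X \<and> Tychonoff_space Y \<and>
    Nt (prod_topology X Y) <o card_min (Nt X) (Nt Y)"
proof -
  obtain S :: "real suc set" where S: "stationary S" "stationary (- S)"
    by (rule stationary_split)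
  define \<D> where "\<D> S = (`) Rep_suc ` limit_ideal S" for S :: "real suc set"
  define X where "X S = ideal_topology (\<D> S)" for S
  have inj: "inj (Rep_suc :: real suc \<Rightarrow> real set)" by (simp add: inj_on_def Rep_suc_inject)
  have ideal: "set_ideal (\<D> T)" for T
    unfolding \<D>_def by (intro set_ideal_image set_ideal_limit_ideal)
  have big: "natLeq <o Nt (X T)" if "stationary T" for T
    unfolding X_def
  proof (intro natLeq_less_Nt set_ideal.no_finitely_op_like_base[OF ideal])
    fix \<R> assume "\<R> \<subseteq> \<D> T" "\<forall>C\<in>\<D> T. \<exists>K\<in>\<R>. C \<subseteq> K"
    with limit_ideal_cofinal_bounded[OF that] inj show "\<exists>K\<in>\<D> T. infinite {C \<in> \<R>. C \<subseteq> K}"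
      unfolding \<D>_def by (rule cofinal_bounded_image)
  qed
  have "has_op_like_base (prod_topology (X S) (X (- S))) natLeq"
    unfolding X_def
  proof (rule prod_has_finitely_op_like_base[OF ideal ideal])
    have cover: "\<Union>(\<D> T) = range Rep_suc" for T
      unfolding \<D>_def using limit_ideal_finite[of "{_}" T] by fastforce
    then show "\<Union>(\<D> S) = range Rep_suc" "\<Union>(\<D> (- S)) = range Rep_suc" by simp_all
    have W: "|UNIV :: real suc set| \<le>o |range (Rep_suc :: real suc \<Rightarrow> real set)|"
      using inj card_of_ordLeq by blast
    have "|\<D> T| \<le>o |UNIV :: real suc set|" for T
    proof -
      have "\<D> T \<subseteq> (`) Rep_suc ` {C :: real suc set. countable C}"
        unfolding \<D>_def limit_ideal_def by blast
      then show ?thesis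
        by (rule ordLeq_transitive[OF card_of_mono1
              ordLeq_transitive[OF card_of_image card_countable_sets]])
    qed
    then have "|\<D> S \<times> \<D> (- S)| \<le>o |UNIV :: real suc set|"
      by (intro card_of_Times_ordLeq_infinite_Field)
        (simp_all add: infinite_UNIV_real_suc card_of_card_order_on Field_card_of)
    then show "|\<D> S \<times> \<D> (- S)| \<le>o |range (Rep_suc :: real suc \<Rightarrow> real set)|"
      using W ordLeq_transitive by blast
    fix C assume "C \<in> \<D> S" "C \<in> \<D> (- S)"
    then obtain K K' where "K \<in> limit_ideal S" "C = Rep_suc ` K"
      "K' \<in> limit_ideal (- S)" "C = Rep_suc ` K'"
      unfolding \<D>_def by blast
    moreover from this have "K = K'" using inj by (simp add: inj_image_eq_iff)
    ultimately show "finite C" using limit_ideals_orthogonal by blast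
  qed
  then have "Nt (prod_topology (X S) (X (- S))) \<le>o natLeq"
    by (rule Nt_least[OF natLeq_Cinfinite])
  then have "Nt (prod_topology (X S) (X (- S))) <o card_min (Nt (X S)) (Nt (X (- S)))"
    unfolding card_min_def using big S ordLeq_ordLess_trans by (auto split: if_splits)
  moreover have "Tychonoff_space (X T)" for T
    unfolding X_def using set_ideal.Tychonoff_ideal_topology[OF ideal] .
  ultimately show ?thesis by blast
qed

end
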